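(* Let $(Q,+)$ be a group, $\varphi,\psi\in Aut(Q,+)$, $c\in Q$, and let $(Q,A)$ be the left alinear right linear quasigroup $A(x,y)=I\varphi x+\psi y+c$. Then the following equivalences hold: 1. $A\bot A^{(12)}$ if and only if the map $(-\varphi^{-1}\psi+\psi^{-1}\varphi)$ is a permutation of $Q$; 2. $A\bot A^{(13)}$ if and only if for every $b\in Q$ the map $(\varphi+IJ_{(Ib+c)})$ is a permutation of $Q$; 3. $A\bot A^{(23)}$ if and only if the map $(\psi+\varepsilon)$ is a permutation of $Q$; 4. $A\bot A^{(123)}$ if and only if for every $t\in Q$ the map $(\psi^2+\varphi IJ_t)$ is a permutation of $Q$; 5. $A\bot A^{(132)}$ if and only if the map $(\varphi^2+\psi)$ is a permutation of $Q$.
   Context: Groups are written additively but need not be commutative. Products of maps are compositions; sums of maps are pointwise in the written order: $(f+g)x=fx+gx$, $(-f+g)x=-(fx)+gx$. A permutation of $Q$ is a bijection $Q\to Q$; $\varepsilon$ is the identity map; $Ix=-x$; $J_tx=t+x-t$ for $t\in Q$. The parastrophes of a quasigroup $(Q,A)$ are the quasigroup operations defined by: $A(x_1,x_2)=x_3\Leftrightarrow A^{(12)}(x_2,x_1)=x_3\Leftrightarrow A^{(13)}(x_3,x_2)=x_1\Leftrightarrow A^{(23)}(x_1,x_3)=x_2\Leftrightarrow A^{(123)}(x_2,x_3)=x_1\Leftrightarrow A^{(132)}(x_3,x_1)=x_2$. For quasigroup operations $A,B$ on $Q$, $A\bot B$ ($A$ and $B$ are orthogonal) means that for all $a,b\in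 Q$ the system $A(x,y)=a$, $B(x,y)=b$ has a unique solution $(x,y)\in Q\times Q$. *)

theory Defs
  imports Main "HOL-Library.Function_Algebras"
begin

text \<open>
  The class \<^class>\<open>group_add\<close> does not assume commutativity.  Sums and negatives
  of maps are pointwise, the map $I$ is
  \<^term>\<open>uminus :: 'a::group_add \<Rightarrow> 'a\<close>, and products of maps are written with
  \<open>\<circ>\<close> and \<open>^^\<close>: the operators \<open>*\<close> and \<open>^\<close> on functions
  would be pointwise.
\<close>

definition group_aut :: "('a::group_add \<Rightarrow> 'a) \<Rightarrow> bool" where
  "group_aut f \<longleftrightarrow> bij f \<and> (\<forall>x y. f (x + y) = f x + f y)"

definition conj_map :: "'a::group_add \<Rightarrow> 'a \<Rightarrow> 'a" where
  "conj_map t x = t + x - t"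

definition quasigroup :: "('a \<Rightarrow> 'a \<Rightarrow> 'a) \<Rightarrow> bool" where
  "quasigroup A \<longleftrightarrow> (\<forall>a b. \<exists>!x. A x a = b) \<and> (\<forall>a b. \<exists>!y. A a y = b)"

text \<open>
  The parastrophes are meaningful for quasigroups only; the lemmas
  \<open>parastrophe_iff\<close> and \<open>quasigroup_parastrophes\<close> below show that
  they are then the quasigroup operations determined by the usual equivalences.
\<close>

definition par12 :: "('a \<Rightarrow> 'a \<Rightarrow> 'a) \<Rightarrow> 'a \<Rightarrow> 'a \<Rightarrow> 'a" where
  "par12 A x2 x1 = A x1 x2"

definition par13 :: "('a \<Rightarrow> 'a \<Rightarrow> 'a) \<Rightarrow> 'a \<Rightarrow> 'a \<Rightarrow> 'a" where
  "par13 A x3 x2 = (THE x1. A x1 x2 = x3)"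

definition par23 :: "('a \<Rightarrow> 'a \<Rightarrow> 'a) \<Rightarrow> 'a \<Rightarrow> 'a \<Rightarrow> 'a" where
  "par23 A x1 x3 = (THE x2. A x1 x2 = x3)"

definition par123 :: "('a \<Rightarrow> 'a \<Rightarrow> 'a) \<Rightarrow> 'a \<Rightarrow> 'a \<Rightarrow> 'a" where
  "par123 A x2 x3 = (THE x1. A x1 x2 = x3)"

definition par132 :: "('a \<Rightarrow> 'a \<Rightarrow> 'a) \<Rightarrow> 'a \<Rightarrow> 'a \<Rightarrow> 'a" where
  "par132 A x3 x1 = (THE x2. A x1 x2 = x3)"

definition orthogonal_ops :: "('a \<Rightarrow> 'a \<Rightarrow> 'a) \<Rightarrow> ('a \<Rightarrow> 'a \<Rightarrow> 'a) \<Rightarrow> bool"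
    (infix "\<bottom>\<^sub>q" 50) where
  "A \<bottom>\<^sub>q B \<longleftrightarrow> (\<forall>a b. \<exists>!p. A (fst p) (snd p) = a \<and> B (fst p) (snd p) = b)"

lemma parastrophe_iff:
  assumes "quasigroup A"
  shows "par12 A x2 x1 = x3 \<longleftrightarrow> A x1 x2 = x3"
    and "par13 A x3 x2 = x1 \<longleftrightarrow> A x1 x2 = x3"
    and "par23 A x1 x3 = x2 \<longleftrightarrow> A x1 x2 = x3"
    and "par123 A x2 x3 = x1 \<longleftrightarrow> A x1 x2 = x3"
    and "par132 A x3 x1 = x2 \<longleftrightarrow> A x1 x2 = x3"
proof -
  have L: "\<exists>!x. A x a = b" and R: "\<exists>!y. A a y = b" for a b
    using assms by (auto simp: quasigroup_def)
  have 1: "(THE x. A x a = b) = z \<longleftrightarrow> A z a = b" for a b z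
    using theI'[OF L[of a b]] the1_equality[OF L[of a b], of z] by auto
  have 2: "(THE y. A a y = b) = z \<longleftrightarrow> A a z = b" for a b z
    using theI'[OF R[of a b]] the1_equality[OF R[of a b], of z] by auto
  show "par12 A x2 x1 = x3 \<longleftrightarrow> A x1 x2 = x3"
    by (simp add: par12_def)
  show "par13 A x3 x2 = x1 \<longleftrightarrow> A x1 x2 = x3"
    unfolding par13_def by (rule 1)
  show "par23 A x1 x3 = x2 \<longleftrightarrow> A x1 x2 = x3"
    unfolding par23_def by (rule 2)
  show "par123 A x2 x3 = x1 \<longleftrightarrow> A x1 x2 = x3"
    unfolding par123_def by (rule 1)
  show "par132 A x3 x1 = x2 \<longleftrightarrow> A x1 x2 = x3"
    unfolding par132_def by (rule 2)
qed

lemma quasigroup_parastrophes: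
  assumes "quasigroup A"
  shows "quasigroup (par12 A)" "quasigroup (par13 A)" "quasigroup (par23 A)"
    "quasigroup (par123 A)" "quasigroup (par132 A)"
proof -
  have L: "\<exists>!x. A x a = b" and R: "\<exists>!y. A a y = b" and T: "\<exists>!z. A a b = z" for a b
    using assms by (auto simp: quasigroup_def)
  show "quasigroup (par12 A)" "quasigroup (par13 A)" "quasigroup (par23 A)"
    "quasigroup (par123 A)" "quasigroup (par132 A)"
    unfolding quasigroup_def parastrophe_iff[OF assms] by (intro conjI allI L R T)+
qed

lemma quasigroup_alinear_linear:
  fixes \<phi> \<psi> :: "'a::group_add \<Rightarrow> 'a"
  assumes "group_aut \<phi>" "group_aut \<psi>"
  shows "quasigroup (\<lambda>x y. - \<phi> x + \<psi> y + c)"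
proof -
  have p: "\<exists>!x. \<phi> x = a" and q: "\<exists>!x. \<psi> x = a" for a
    using assms by (auto simp: group_aut_def bij_iff)
  have g: "- p + r + c = b \<longleftrightarrow> r + c = p + b" for p r b :: 'a
  proof
    assume "- p + r + c = b"
    then show "r + c = p + b" by (simp add: add.assoc flip: \<open>- p + r + c = b\<close>)
  qed (simp add: add.assoc)
  have 1: "- \<phi> x + \<psi> a + c = b \<longleftrightarrow> \<phi> x = \<psi> a + c - b" for x a b
    unfolding g by (subst eq_diff_eq) (rule eq_commute)
  have 2: "- \<phi> a + \<psi> y + c = b \<longleftrightarrow> \<psi> y = \<phi> a + b - c" for y a b
    unfolding g by (simp only: eq_diff_eq)
  have "\<exists>!x. - \<phi> x + \<psi> a + c = b" for a b
    unfolding 1 by (rule p)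
  moreover have "\<exists>!y. - \<phi> a + \<psi> y + c = b" for a b
    unfolding 2 by (rule q)
  ultimately show ?thesis
    unfolding quasigroup_def by (intro conjI allI)
qed

end

theory Submission
  imports Defs
begin

text \<open>
  For each parastrophe the equation \<open>B x y = b\<close> can be solved explicitly for one
  of the unknowns, so orthogonality says that the map obtained by substituting the solution into
  \<open>A\<close> is bijective for every \<open>b\<close>.  Up to translations, negation and
  automorphisms applied before or after it, that map is the one in the statement.
\<close>

text \<open>The second condition describes the graph of \<open>h\<close>, which its second
  coordinate parametrises, so a unique pair amounts to a unique \<open>y\<close>.\<close>

lemma ex1_pair_left:
  "(\<exists>!p. P (fst p) (snd p) \<and> fst p = h (snd p)) \<longleftrightarrow> (\<exists>!y. P (h y) y)"
proof
  assume "\<exists>!p. P (fst p) (snd p) \<and> fst p = h (snd p)"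
  then obtain p where p: "P (fst p) (snd p)" "fst p = h (snd p)"
    and u: "\<And>q. P (fst q) (snd q) \<and> fst q = h (snd q) \<Longrightarrow> q = p"
    by (elim ex1E) blast
  show "\<exists>!y. P (h y) y"
  proof (rule ex1I)
    show "P (h (snd p)) (snd p)"
      using p by simp
    show "y = snd p" if "P (h y) y" for y
      using u[of "(h y, y)"] that by auto
  qed
next
  assume "\<exists>!y. P (h y) y"
  then obtain y where y: "P (h y) y" "\<And>z. P (h z) z \<Longrightarrow> z = y"
    by blast
  show "\<exists>!p. P (fst p) (snd p) \<and> fst p = h (snd p)"
  proof (rule ex1I)
    show "P (fst (h y, y)) (snd (h y, y)) \<and> fst (h y, y) = h (snd (h y, y))"
      using y(1) by simp
    show "p = (h y, y)" if "P (fst p) (snd p) \<and> fst p = h (snd p)" for p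
      using that y(2)[of "snd p"] by (cases p) auto
  qed
qed

lemma ex1_pair_right:
  "(\<exists>!p. P (fst p) (snd p) \<and> snd p = h (fst p)) \<longleftrightarrow> (\<exists>!x. P x (h x))"
proof -
  have swap: "(\<exists>!p. R p) \<longleftrightarrow> (\<exists>!q. R (prod.swap q))" for R :: "'a \<times> 'b \<Rightarrow> bool"
    unfolding Ex1_def by (metis swap_swap)
  show ?thesis
    using ex1_pair_left[of "\<lambda>y x. P x y" h] by (subst swap) simp
qed

text \<open>For fixed \<open>b\<close> the system shrinks to the single equation
  \<open>A (h b y) y = a\<close>, and unique solvability for all \<open>a\<close> is bijectivity. It
  remains to exchange the quantifiers over \<open>a\<close> and \<open>b\<close>.\<close>

lemma orthogonal_ops_iff_bij_left:
  assumes "\<And>b x y. B x y = b \<longleftrightarrow> x = h b y"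
  shows "A \<bottom>\<^sub>q B \<longleftrightarrow> (\<forall>b. bij (\<lambda>y. A (h b y) y))"
  unfolding orthogonal_ops_def assms bij_iff ex1_pair_left[of "\<lambda>x y. A x y = a" for a]
  by (rule all_comm)

lemma orthogonal_ops_iff_bij_right:
  assumes "\<And>b x y. B x y = b \<longleftrightarrow> y = h b x"
  shows "A \<bottom>\<^sub>q B \<longleftrightarrow> (\<forall>b. bij (\<lambda>x. A x (h b x)))"
  unfolding orthogonal_ops_def assms bij_iff ex1_pair_right[of "\<lambda>x y. A x y = a" for a]
  by (rule all_comm)

text \<open>This serves to change the index of a family of maps, for instance from
  \<open>\<phi> b\<close> to an arbitrary group element.\<close>

lemma surj_all_iff:
  assumes "surj f"
  shows "(\<forall>x. P (f x)) \<longleftrightarrow> (\<forall>y. P y)"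
  using assms by (metis surjD)

text \<open>Bijections on either side cancel. The factorisation is assumed pointwise, so that each
  use states it as an explicit identity in the group; an \<open>id\<close> put in there marks a
  trivial inner or outer map.\<close>

lemma bij_comp_iff:
  assumes "bij g" "bij h" "\<And>x. F x = g (f (h x))"
  shows "bij F \<longleftrightarrow> bij f"
proof -
  have F: "F = g \<circ> (f \<circ> h)"
    using assms(3) by auto
  have "bij F \<longleftrightarrow> bij (f \<circ> h)"
    unfolding F using bij_betw_comp_iff2[OF assms(1), of "f \<circ> h" UNIV] by simp
  also have "\<dots> \<longleftrightarrow> bij f"
    using bij_betw_comp_iff[OF assms(2), of f UNIV] by simp
  finally show ?thesis .
qed

lemma bij_translation:
  fixes a b :: "'a::group_add"
  shows "bij (\<lambda>x. a + x + b)"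
  by (rule bij_betw_byWitness[where f' = "\<lambda>x. - a + x - b"])
    (auto simp: add.assoc diff_conv_add_uminus simp del: add_uminus_conv_diff)

lemma bij_uminus_translation:
  fixes a b :: "'a::group_add"
  shows "bij (\<lambda>x. a - x + b)"
  using bij_comp[OF bij_uminus bij_translation[of a b]] by (simp add: comp_def)

lemma minus_add_eq_iff:
  fixes a b c d :: "'a::group_add"
  shows "- a + b + c = d \<longleftrightarrow> b + c = a + d"
  by (metis add.assoc add_minus_cancel minus_add_cancel)

lemma group_autD:
  assumes "group_aut f"
  shows "bij f" "f (x + y) = f x + f y" "f (- x) = - f x" "f (x - y) = f x - f y"
    "f (inv f x) = x" "inv f (f x) = x"
proof -
  show "bij f" and add: "\<And>x y. f (x + y) = f x + f y"
    using assms by (auto simp: group_aut_def)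
  have "f 0 = 0"
    using add[of 0 0] by (metis add.right_neutral add_left_cancel)
  then show minus: "\<And>x. f (- x) = - f x"
    using add by (metis add.right_inverse minus_unique)
  show "f (x - y) = f x - f y"
    using add[of x "- y"] minus by simp
  show "f (inv f x) = x" "inv f (f x) = x"
    using \<open>bij f\<close> by (simp_all add: bij_is_surj surj_f_inv_f bij_is_inj)
qed

lemma group_aut_inv:
  assumes "group_aut f"
  shows "group_aut (inv f)"
  unfolding group_aut_def
proof (intro conjI allI)
  show "bij (inv f)"
    by (rule bij_imp_bij_inv[OF group_autD(1)[OF assms]])
  show "inv f (x + y) = inv f x + inv f y" for x y
    using group_autD(6)[OF assms, of "inv f x + inv f y"]
    by (simp add: group_autD(2,5)[OF assms])
qed

context
  fixes \<phi> \<psi> :: "'a::group_add \<Rightarrow> 'a" and c :: 'a and A :: "'a \<Rightarrow> 'a \<Rightarrow> 'a"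
  assumes \<phi>: "group_aut \<phi>" and \<psi>: "group_aut \<psi>"
    and A: "\<And>x y. A x y = - \<phi> x + \<psi> y + c"
begin

lemma quasigroup_A: "quasigroup A"
proof -
  have "A = (\<lambda>x y. - \<phi> x + \<psi> y + c)"
    by (intro ext A)
  then show ?thesis
    using quasigroup_alinear_linear[OF \<phi> \<psi>] by simp
qed

lemmas par_iff = parastrophe_iff[OF quasigroup_A]

lemmas aut_simps = group_autD(2-6)[OF \<phi>] group_autD(2-6)[OF \<psi>]
  group_autD(2-4)[OF group_aut_inv[OF \<phi>]] group_autD(2-4)[OF group_aut_inv[OF \<psi>]]

text \<open>These turn both sides of an identity into right-nested sums of elements and negatives.
  The rule \<open>add_uminus_conv_diff\<close> is deleted at each use because it would turn the
  negatives back into differences.\<close>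

lemmas group_normalize = add.assoc minus_add diff_conv_add_uminus

lemma A_eq_iff_left: "A x y = b \<longleftrightarrow> x = inv \<phi> (\<psi> y + c - b)"
proof -
  have "A x y = b \<longleftrightarrow> \<phi> x = \<psi> y + c - b"
    unfolding A minus_add_eq_iff by (auto simp: eq_diff_eq)
  also have "\<dots> \<longleftrightarrow> x = inv \<phi> (\<psi> y + c - b)"
    by (metis group_autD(5,6)[OF \<phi>])
  finally show ?thesis .
qed

lemma A_eq_iff_right: "A x y = b \<longleftrightarrow> y = inv \<psi> (\<phi> x + b - c)"
proof -
  have "A x y = b \<longleftrightarrow> \<psi> y = \<phi> x + b - c"
    unfolding A minus_add_eq_iff by (simp add: eq_diff_eq)
  also have "\<dots> \<longleftrightarrow> y = inv \<psi> (\<phi> x + b - c)"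
    by (metis group_autD(5,6)[OF \<psi>])
  finally show ?thesis .
qed

lemma orthogonal_par12_iff:
  "A \<bottom>\<^sub>q par12 A \<longleftrightarrow> bij (- (inv \<phi> \<circ> \<psi>) + (inv \<psi> \<circ> \<phi>))"
proof -
  have "A \<bottom>\<^sub>q par12 A \<longleftrightarrow> (\<forall>b. bij (\<lambda>y. A (inv \<psi> (\<phi> y + b - c)) y))"
    by (rule orthogonal_ops_iff_bij_left) (simp add: par_iff A_eq_iff_right)
  \<comment> \<open>The right-hand map does not depend on \<open>b\<close>; the vacuous quantifier
    allows the comparison to be made for each \<open>b\<close> separately.\<close>
  also have "\<dots> \<longleftrightarrow> (\<forall>b::'a. bij (- (inv \<phi> \<circ> \<psi>) + (inv \<psi> \<circ> \<phi>)))"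
  proof (intro all_cong1 bij_comp_iff)
    fix b y
    \<comment> \<open>Negating \<open>\<phi> (inv \<psi> (\<phi> y + b - c))\<close> moves its
      constant part to the far left, away from the varying summands. Factoring out
      \<open>\<phi>\<close> leaves the two quotients of the automorphisms, and the minus sign
      restores their order.\<close>
    let ?g = "\<lambda>x. - \<phi> (inv \<psi> (b - c)) - x + c"
    show "bij (?g \<circ> \<phi>)"
      by (intro bij_comp group_autD(1)[OF \<phi>] bij_uminus_translation)
    show "A (inv \<psi> (\<phi> y + b - c)) y =
        (?g \<circ> \<phi>) ((- (inv \<phi> \<circ> \<psi>) + (inv \<psi> \<circ> \<phi>)) (id y))"
      by (simp add: A aut_simps group_normalize del: add_uminus_conv_diff)
  qed (simp add: bij_id[unfolded id_def])
  finally show ?thesis by simp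
qed

text \<open>Here the constant stays between the two varying summands and in general cannot be moved
  out without commutativity, so a family of maps remains. The conjugation form differs by a
  translation only: \<open>\<phi> x - (t + x - t)\<close> equals
  \<open>\<phi> x + t - x - t\<close>.\<close>

lemma orthogonal_par13_iff:
  "A \<bottom>\<^sub>q par13 A \<longleftrightarrow> (\<forall>b. bij (\<phi> + (uminus \<circ> conj_map (- b + c))))"
proof -
  let ?F = "\<lambda>t x. \<phi> x + t - x"
  have "A \<bottom>\<^sub>q par13 A \<longleftrightarrow> (\<forall>b. bij (\<lambda>x. A x (inv \<psi> (\<phi> b + x - c))))"
    by (rule orthogonal_ops_iff_bij_right) (simp add: par_iff A_eq_iff_right)
  also have "\<dots> \<longleftrightarrow> (\<forall>b. bij (?F (\<phi> b)))"
  proof (intro all_cong1 bij_comp_iff)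
    fix b x
    show "A x (inv \<psi> (\<phi> b + x - c)) = id (?F (\<phi> b) (- x))"
      by (simp add: A aut_simps group_normalize del: add_uminus_conv_diff)
  qed (simp_all add: bij_uminus bij_id[unfolded id_def])
  also have "\<dots> \<longleftrightarrow> (\<forall>t. bij (?F t))"
    by (rule surj_all_iff[OF bij_is_surj[OF group_autD(1)[OF \<phi>]]])
  \<comment> \<open>The elements \<open>- b + c\<close> exhaust the group.\<close>
  also have "\<dots> \<longleftrightarrow> (\<forall>b. bij (?F (- b + c)))"
    by (rule surj_all_iff[symmetric])
      (use bij_is_surj[OF bij_uminus_translation[of 0 c]] in simp)
  also have "\<dots> \<longleftrightarrow> (\<forall>b. bij (\<phi> + (uminus \<circ> conj_map (- b + c))))"
  proof (intro all_cong1 bij_comp_iff[symmetric])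
    fix b x
    show "bij (\<lambda>x. 0 + x - (- b + c))"
      using bij_translation[of 0 "- (- b + c)"] by simp
    show "(\<phi> + (uminus \<circ> conj_map (- b + c))) x = 0 + ?F (- b + c) (id x) - (- b + c)"
      by (simp add: conj_map_def group_normalize del: add_uminus_conv_diff)
  qed (simp add: bij_id[unfolded id_def])
  finally show ?thesis .
qed

lemma orthogonal_par23_iff: "A \<bottom>\<^sub>q par23 A \<longleftrightarrow> bij (\<psi> + id)"
proof -
  \<comment> \<open>The equation \<open>par23 A x y = b\<close> means \<open>A x b = y\<close>,
    which is solved for \<open>x\<close>.\<close>
  have "A \<bottom>\<^sub>q par23 A \<longleftrightarrow> (\<forall>b. bij (\<lambda>y. A (inv \<phi> (\<psi> b + c - y)) y))"
    by (rule orthogonal_ops_iff_bij_left) (simp add: par_iff A_eq_iff_left)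
  also have "\<dots> \<longleftrightarrow> (\<forall>b::'a. bij (\<psi> + id))"
  proof (intro all_cong1 bij_comp_iff)
    fix b y
    let ?k = "\<psi> b + c"
    show "bij (\<lambda>x. 0 - x + (\<psi> ?k + c))" "bij (\<lambda>y. ?k - y + 0)"
      by (rule bij_uminus_translation)+
    \<comment> \<open>The substitution \<open>?k - y\<close> absorbs the constant between the two summands.\<close>
    show "A (inv \<phi> (\<psi> b + c - y)) y = 0 - (\<psi> + id) (?k - y + 0) + (\<psi> ?k + c)"
      by (simp add: A aut_simps group_normalize del: add_uminus_conv_diff)
  qed
  finally show ?thesis by simp
qed

lemma orthogonal_par123_iff:
  "A \<bottom>\<^sub>q par123 A \<longleftrightarrow> (\<forall>t. bij ((\<psi> ^^ 2) + (\<phi> \<circ> uminus \<circ> conj_map t)))"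
proof -
  let ?F = "\<lambda>s x. \<psi> (\<psi> x) + s - \<phi> x"
  \<comment> \<open>The equation \<open>par123 A x y = b\<close> means \<open>A b x = y\<close>, so
    \<open>y\<close> is already explicit and no inverse automorphism enters.\<close>
  have "A \<bottom>\<^sub>q par123 A \<longleftrightarrow> (\<forall>b. bij (\<lambda>x. A x (A b x)))"
    by (rule orthogonal_ops_iff_bij_right) (auto simp: par_iff)
  also have "\<dots> \<longleftrightarrow> (\<forall>b. bij (?F (\<psi> (\<phi> b))))"
  proof (intro all_cong1 bij_comp_iff)
    fix b x
    show "bij (\<lambda>x. 0 - x + (\<psi> c + c))"
      by (rule bij_uminus_translation)
    show "A x (A b x) = 0 - ?F (\<psi> (\<phi> b)) (- x) + (\<psi> c + c)"
      by (simp add: A aut_simps group_normalize del: add_uminus_conv_diff)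
  qed (rule bij_uminus)
  also have "\<dots> \<longleftrightarrow> (\<forall>s. bij (?F s))"
    by (rule surj_all_iff[of "\<lambda>b. \<psi> (\<phi> b)"])
      (use bij_is_surj[OF bij_comp[OF group_autD(1)[OF \<phi>] group_autD(1)[OF \<psi>]]] in \<open>simp add: comp_def\<close>)
  \<comment> \<open>With \<open>s = \<phi> t\<close>, the sum \<open>s - \<phi> x - \<phi> t\<close>
    is the image of \<open>- conj_map t x\<close> under \<open>\<phi>\<close>.\<close>
  also have "\<dots> \<longleftrightarrow> (\<forall>t. bij (?F (\<phi> t)))"
    by (rule surj_all_iff[OF bij_is_surj[OF group_autD(1)[OF \<phi>]], symmetric])
  also have "\<dots> \<longleftrightarrow> (\<forall>t. bij ((\<psi> ^^ 2) + (\<phi> \<circ> uminus \<circ> conj_map t)))"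
  proof (intro all_cong1 bij_comp_iff[symmetric])
    fix t x
    show "bij (\<lambda>x. 0 + x + - \<phi> t)"
      by (rule bij_translation)
    show "((\<psi> ^^ 2) + (\<phi> \<circ> uminus \<circ> conj_map t)) x = 0 + ?F (\<phi> t) (id x) + - \<phi> t"
      by (simp add: numeral_2_eq_2 conj_map_def aut_simps group_normalize
          del: add_uminus_conv_diff)
  qed (simp add: bij_id[unfolded id_def])
  finally show ?thesis .
qed

text \<open>The outer negation reverses the inner sum, so the constant coming from \<open>b\<close>
  goes to the far left and \<open>\<phi> (\<phi> y)\<close> lands next to \<open>\<psi> y\<close>.
  Hence the condition is the same for every \<open>b\<close>.\<close>

lemma orthogonal_par132_iff: "A \<bottom>\<^sub>q par132 A \<longleftrightarrow> bij ((\<phi> ^^ 2) + \<psi>)"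
proof -
  have "A \<bottom>\<^sub>q par132 A \<longleftrightarrow> (\<forall>b. bij (\<lambda>y. A (A y b) y))"
    by (rule orthogonal_ops_iff_bij_left) (auto simp: par_iff)
  also have "\<dots> \<longleftrightarrow> (\<forall>b::'a. bij ((\<phi> ^^ 2) + \<psi>))"
  proof (intro all_cong1 bij_comp_iff)
    fix b y
    show "bij (\<lambda>x. - \<phi> (\<psi> b + c) + x + c)"
      by (rule bij_translation)
    show "A (A y b) y = - \<phi> (\<psi> b + c) + ((\<phi> ^^ 2) + \<psi>) (id y) + c"
      by (simp add: numeral_2_eq_2 A aut_simps group_normalize del: add_uminus_conv_diff)
  qed (simp add: bij_id[unfolded id_def])
  finally show ?thesis by simp
qed

end

theorem theorem55:
  fixes \<phi> \<psi> :: "'a::group_add \<Rightarrow> 'a" and c :: 'a and A :: "'a \<Rightarrow> 'a \<Rightarrow> 'a"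
  assumes "group_aut \<phi>" and "group_aut \<psi>"
    and "\<And>x y. A x y = - \<phi> x + \<psi> y + c"
  shows "(A \<bottom>\<^sub>q par12 A \<longleftrightarrow> bij (- (inv \<phi> \<circ> \<psi>) + (inv \<psi> \<circ> \<phi>))) \<and>
    (A \<bottom>\<^sub>q par13 A \<longleftrightarrow> (\<forall>b. bij (\<phi> + (uminus \<circ> conj_map (- b + c))))) \<and>
    (A \<bottom>\<^sub>q par23 A \<longleftrightarrow> bij (\<psi> + id)) \<and>
    (A \<bottom>\<^sub>q par123 A \<longleftrightarrow> (\<forall>t. bij ((\<psi> ^^ 2) + (\<phi> \<circ> uminus \<circ> conj_map t)))) \<and>
    (A \<bottom>\<^sub>q par132 A \<longleftrightarrow> bij ((\<phi> ^^ 2) + \<psi>))"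
  by (intro conjI orthogonal_par12_iff[OF assms] orthogonal_par13_iff[OF assms]
      orthogonal_par23_iff[OF assms] orthogonal_par123_iff[OF assms] orthogonal_par132_iff[OF assms])

end
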